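(* Let $W\subsetneq\mathbb{C}$ be a simply connected domain. Suppose that $f$ is an analytic function on $W$ such that $\limsup_{z\to\partial W}|f(z)|\le K<\infty$, and that there are constants $C>0$ and $p$ with $0<p<\frac14$ such that $|f(z)|\le Ce^{C|z|^{2p}}+C$ for all $z\in W$. Then $|f(z)|\le K$ for all $z\in W$.
   Context: A domain is a nonempty connected open subset of $\mathbb{C}$. $\partial W$ denotes the boundary of $W$ in $\mathbb{C}$ (the point at $\infty$ is not included). The condition $\limsup_{z\to\partial W}|f(z)|\le K$ means that for every $\zeta\in\partial W$, $\limsup_{z\to\zeta,\, z\in W}|f(z)|\le K$. *)

theory Defs
  imports "HOL-Complex_Analysis.Complex_Analysis"
begin

end

(* Carleman's method. Let a be outside W and m > max K 0, and suppose |f| > m somewhere. With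
   Phi(x) = x - arctan x for x > 0 and 0 otherwise, which is convex, C^2 and of linear growth,
   the function G(t,x) = Phi(log(|f|/m)) at the point a + exp(t + ix), extended by 0 off W, is C^2 and
   subharmonic, vanishes for t near minus infinity, and, as W is simply connected, has a zero on every
   circle t = const. Hence M(t), the integral of G^2 over the circle, satisfies
   M'' >= 2 (int G_t^2 + int G_x^2), where int G_x^2 >= l^2 M for every l < 1/2 by a Wirtinger inequality
   and M'^2 <= 4 M int G_t^2 by Cauchy-Schwarz; that is, (sqrt M)'' >= l^2 sqrt M. So M grows at least
   like exp(2 l t), while the growth hypothesis gives M = O(exp(4 p t)): a contradiction when 2 p < l. *)

theory Submission
  imports Defs
begin

subsection \<open>Wirtinger inequality\<close>

text \<open>Integrate \<open>(g' + l g T)\<^sup>2 \<ge> 0\<close> for \<open>T x = tan (l (x - c))\<close>, using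
  \<open>(l g\<^sup>2 T)' = 2 l g g' T + l\<^sup>2 g\<^sup>2 (1 + T\<^sup>2)\<close>.\<close>

lemma weighted_wirtinger:
  fixes g g' :: "real \<Rightarrow> real"
  assumes "a \<le> b"
    and deriv: "\<And>x. x \<in> {a..b} \<Longrightarrow> (g has_real_derivative g' x) (at x)"
    and cont: "continuous_on {a..b} g'"
    and range: "\<And>x. x \<in> {a..b} \<Longrightarrow> \<bar>l * (x - c)\<bar> < pi / 2"
  shows "l\<^sup>2 * integral {a..b} (\<lambda>x. (g x)\<^sup>2) + l * (g a)\<^sup>2 * tan (l * (a - c)) - l * (g b)\<^sup>2 * tan (l * (b - c))
    \<le> integral {a..b} (\<lambda>x. (g' x)\<^sup>2)"
proof -
  define T where "T = (\<lambda>x. tan (l * (x - c)))"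
  have cos: "cos (l * (x - c)) \<noteq> 0" if "x \<in> {a..b}" for x
    using range[OF that] by (intro less_imp_neq[symmetric] cos_gt_zero_pi) linarith+
  have contg: "continuous_on {a..b} g"
    using deriv by (meson DERIV_atLeastAtMost_imp_continuous_on atLeastAtMost_iff)
  have contT: "continuous_on {a..b} T"
    unfolding T_def by (intro continuous_intros ballI cos)
  have "((\<lambda>x. l * (g x)\<^sup>2 * T x) has_vector_derivative
          2 * l * g x * g' x * T x + l\<^sup>2 * (g x)\<^sup>2 * (1 + (T x)\<^sup>2)) (at x within {a..b})"
    if "x \<in> {a..b}" for x
  proof -
    have "(T has_real_derivative l * (1 + (T x)\<^sup>2)) (at x)"
      unfolding T_def using cos[OF that]
      by (auto intro!: derivative_eq_intros simp: tan_sec field_simps)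
    from DERIV_mult[OF DERIV_cmult[OF DERIV_power[OF deriv[OF that], of 2], of l] this]
    have "((\<lambda>x. l * (g x)\<^sup>2 * T x) has_real_derivative
          2 * l * g x * g' x * T x + l\<^sup>2 * (g x)\<^sup>2 * (1 + (T x)\<^sup>2)) (at x)"
      by (rule DERIV_cong) (simp add: algebra_simps power2_eq_square)
    then show ?thesis
      by (simp add: has_field_derivative_at_within flip: has_real_derivative_iff_has_vector_derivative)
  qed
  then have "((\<lambda>x. 2 * l * g x * g' x * T x + l\<^sup>2 * (g x)\<^sup>2 * (1 + (T x)\<^sup>2)) has_integral
      l * (g b)\<^sup>2 * T b - l * (g a)\<^sup>2 * T a) {a..b}"
    by (rule fundamental_theorem_of_calculus[OF \<open>a \<le> b\<close>])
  moreover have "((\<lambda>x. (g' x)\<^sup>2) has_integral integral {a..b} (\<lambda>x. (g' x)\<^sup>2)) {a..b}"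
    "((\<lambda>x. (g x)\<^sup>2) has_integral integral {a..b} (\<lambda>x. (g x)\<^sup>2)) {a..b}"
    by (intro integrable_integral integrable_continuous_interval continuous_intros cont contg)+
  ultimately have "((\<lambda>x. (g' x)\<^sup>2 - l\<^sup>2 * (g x)\<^sup>2
        + (2 * l * g x * g' x * T x + l\<^sup>2 * (g x)\<^sup>2 * (1 + (T x)\<^sup>2))) has_integral
      integral {a..b} (\<lambda>x. (g' x)\<^sup>2) - l\<^sup>2 * integral {a..b} (\<lambda>x. (g x)\<^sup>2)
        + (l * (g b)\<^sup>2 * T b - l * (g a)\<^sup>2 * T a)) {a..b}"
    by (intro has_integral_add has_integral_diff has_integral_mult_right)
  then have "0 \<le> integral {a..b} (\<lambda>x. (g' x)\<^sup>2) - l\<^sup>2 * integral {a..b} (\<lambda>x. (g x)\<^sup>2)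
        + (l * (g b)\<^sup>2 * T b - l * (g a)\<^sup>2 * T a)"
  proof (rule has_integral_nonneg)
    fix x
    have "(g' x)\<^sup>2 - l\<^sup>2 * (g x)\<^sup>2 + (2 * l * g x * g' x * T x + l\<^sup>2 * (g x)\<^sup>2 * (1 + (T x)\<^sup>2))
        = (g' x + l * g x * T x)\<^sup>2"
      by (simp add: power2_eq_square algebra_simps)
    then show "0 \<le> (g' x)\<^sup>2 - l\<^sup>2 * (g x)\<^sup>2 + (2 * l * g x * g' x * T x + l\<^sup>2 * (g x)\<^sup>2 * (1 + (T x)\<^sup>2))"
      by (simp only: zero_le_power2)
  qed
  then show ?thesis
    unfolding T_def by linarith
qed

text \<open>The interval is cut at the zero \<open>z\<close>, with the tangent centred at
  \<open>z - pi\<close> on the left piece and at \<open>z + pi\<close> on the right one: read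
  periodically, this is a single weight on the period that starts at \<open>z\<close>. The boundary
  terms at \<open>z\<close> vanish with \<open>g z\<close>; those at \<open>0\<close> and
  \<open>2*pi\<close> cancel, since both have the tangent argument \<open>l * (pi - z)\<close>. The
  bound on \<open>l\<close> keeps the arguments off the poles.\<close>

lemma wirtinger_with_zero:
  fixes g g' :: "real \<Rightarrow> real"
  assumes deriv: "\<And>x. (g has_real_derivative g' x) (at x)"
    and cont: "continuous_on UNIV g'"
    and ends: "g (2 * pi) = g 0"
    and z: "z \<in> {0..2*pi}" "g z = 0"
    and l: "\<bar>l\<bar> < 1/2"
  shows "l\<^sup>2 * integral {0..2*pi} (\<lambda>x. (g x)\<^sup>2) \<le> integral {0..2*pi} (\<lambda>x. (g' x)\<^sup>2)"
proof -
  have contg: "continuous_on UNIV g"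
    using deriv DERIV_isCont continuous_at_imp_continuous_on by blast
  have range: "\<bar>l * y\<bar> < pi / 2" if "\<bar>y\<bar> \<le> pi" for y
  proof -
    have "\<bar>l * y\<bar> \<le> \<bar>l\<bar> * pi"
      using that by (simp add: abs_mult mult_left_mono)
    also have "\<dots> < pi / 2"
      using l by simp
    finally show ?thesis .
  qed
  have "l\<^sup>2 * integral {0..z} (\<lambda>x. (g x)\<^sup>2) + l * (g 0)\<^sup>2 * tan (l * (0 - (z - pi)))
        - l * (g z)\<^sup>2 * tan (l * (z - (z - pi))) \<le> integral {0..z} (\<lambda>x. (g' x)\<^sup>2)"
    using z by (intro weighted_wirtinger deriv range continuous_on_subset[OF cont]) auto
  moreover have "l\<^sup>2 * integral {z..2*pi} (\<lambda>x. (g x)\<^sup>2) + l * (g z)\<^sup>2 * tan (l * (z - (z + pi)))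
        - l * (g (2*pi))\<^sup>2 * tan (l * (2*pi - (z + pi))) \<le> integral {z..2*pi} (\<lambda>x. (g' x)\<^sup>2)"
    using z by (intro weighted_wirtinger deriv range continuous_on_subset[OF cont]) auto
  moreover have "integral {0..z} (\<lambda>x. (h x)\<^sup>2) + integral {z..2*pi} (\<lambda>x. (h x)\<^sup>2) = integral {0..2*pi} (\<lambda>x. (h x)\<^sup>2)"
    if "continuous_on UNIV h" for h :: "real \<Rightarrow> real"
    using z by (intro Henstock_Kurzweil_Integration.integral_combine integrable_continuous_interval
        continuous_intros continuous_on_subset[OF that]) auto
  from this[OF contg] this[OF cont] have
    "l\<^sup>2 * integral {0..2*pi} (\<lambda>x. (g x)\<^sup>2)
       = l\<^sup>2 * integral {0..z} (\<lambda>x. (g x)\<^sup>2) + l\<^sup>2 * integral {z..2*pi} (\<lambda>x. (g x)\<^sup>2)"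
    "integral {0..2*pi} (\<lambda>x. (g' x)\<^sup>2)
       = integral {0..z} (\<lambda>x. (g' x)\<^sup>2) + integral {z..2*pi} (\<lambda>x. (g' x)\<^sup>2)"
    by (metis distrib_left)+
  ultimately show ?thesis
    using z ends by (simp add: algebra_simps)
qed

section \<open>A differential inequality that forces exponential growth\<close>

text \<open>The hypothesis \<open>ineq\<close> says that \<open>(sqrt M)'' \<ge> l\<^sup>2 sqrt M\<close>.\<close>

lemma exponential_growth:
  fixes M M' M'' :: "real \<Rightarrow> real"
  assumes M': "\<And>t. (M has_real_derivative M' t) (at t)"
    and M'': "\<And>t. (M' has_real_derivative M'' t) (at t)"
    and convex: "\<And>t. M'' t \<ge> 0"
    and ineq: "\<And>t. M t > 0 \<Longrightarrow> M'' t \<ge> (M' t)\<^sup>2 / (2 * M t) + 2 * l\<^sup>2 * M t"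
    and start: "r < s" "M r = 0" "M s > 0"
    and l: "l \<ge> 0"
  shows "\<exists>c>0. \<forall>t\<ge>s. M t \<ge> c * exp (2 * l * t)"
proof -
  have M'_mono: "M' x \<le> M' y" if "x \<le> y" for x y
    by (rule DERIV_nonneg_imp_nondecreasing[OF that]) (use M'' convex in blast)
  \<comment> \<open>The rise of \<open>M\<close> from 0 at \<open>r\<close> needs a positive slope
    somewhere before \<open>s\<close>. As \<open>M'\<close> is monotone, it is nonnegative from
    \<open>s\<close> on, so \<open>M\<close> stays positive there and its square root is
    differentiable.\<close>
  obtain x where "r < x" "x < s" "M s - M r = (s - r) * M' x"
    using MVT2[OF \<open>r < s\<close>, of M M'] M' by blast
  then have "M' x > 0"
    using start by (metis diff_gt_0_iff_gt diff_zero zero_less_mult_pos)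
  then have M's: "M' s \<ge> 0"
    using M'_mono[of x s] \<open>x < s\<close> by linarith
  have pos: "M t > 0" if "t \<ge> s" for t
  proof -
    have "M s \<le> M t"
    proof (rule DERIV_nonneg_imp_nondecreasing[OF that], intro exI conjI)
      show "(M has_real_derivative M' x) (at x)" for x
        by (rule M')
      show "M' x \<ge> 0" if "s \<le> x" for x
        using M's M'_mono[OF that] by linarith
    qed
    with start show ?thesis by linarith
  qed
  define u where "u = (\<lambda>t. sqrt (M t))"
  define u' where "u' = (\<lambda>t. M' t / (2 * u t))"
  define u'' where "u'' = (\<lambda>t. M'' t / (2 * u t) - M' t * u' t / (2 * (u t)\<^sup>2))"
  have upos: "u t > 0" and u2: "(u t)\<^sup>2 = M t" if "t \<ge> s" for t
    using pos[OF that] by (simp_all add: u_def)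
  have u': "(u has_real_derivative u' t) (at t)" if "t \<ge> s" for t
    unfolding u_def u'_def
    by (rule DERIV_cong[OF DERIV_chain2[OF DERIV_real_sqrt[OF pos[OF that]] M']]) (simp add: field_simps)
  have u'': "(u' has_real_derivative u'' t) (at t)" if "t \<ge> s" for t
  proof -
    have "(M'' t * (2 * u t) - M' t * (2 * u' t)) / (2 * u t * (2 * u t)) = u'' t"
      using upos[OF that] by (simp add: u''_def power2_eq_square field_simps)
    moreover have "2 * u t \<noteq> 0"
      using upos[OF that] by simp
    ultimately have "((\<lambda>t. M' t / (2 * u t)) has_real_derivative u'' t) (at t)"
      by (intro DERIV_cong[OF DERIV_divide[OF M'' DERIV_cmult[OF u'[OF that]]]])
    then show ?thesis
      by (simp only: u'_def)
  qed
  \<comment> \<open>Dividing \<open>ineq\<close> by \<open>2 * u t\<close> turns its quotient term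
    into exactly the term that is subtracted in \<open>u''\<close>.\<close>
  have u''_ge: "u'' t \<ge> l\<^sup>2 * u t" if "t \<ge> s" for t
  proof -
    have "(M' t)\<^sup>2 / (2 * (u t)\<^sup>2) + 2 * l\<^sup>2 * (u t)\<^sup>2 \<le> M'' t"
      using ineq[OF pos[OF that]] u2[OF that] by simp
    then have "((M' t)\<^sup>2 / (2 * (u t)\<^sup>2) + 2 * l\<^sup>2 * (u t)\<^sup>2) / (2 * u t) \<le> M'' t / (2 * u t)"
      using upos[OF that] by (intro divide_right_mono) auto
    moreover have "((M' t)\<^sup>2 / (2 * (u t)\<^sup>2) + 2 * l\<^sup>2 * (u t)\<^sup>2) / (2 * u t)
        = M' t * u' t / (2 * (u t)\<^sup>2) + l\<^sup>2 * u t"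
      using upos[OF that] by (simp add: u'_def field_simps power2_eq_square)
    ultimately show ?thesis
      by (simp add: u''_def)
  qed
  have dexp: "((\<lambda>x. exp (k * (x - s))) has_real_derivative k * exp (k * (x - s))) (at x)" for k x
    by (auto intro!: derivative_eq_intros)
  \<comment> \<open>With D the derivative, D^2 - l^2 = (D + l)(D - l). The exponential is the
    integrating factor of D + l, so the product is nondecreasing; its value at \<open>s\<close> is
    \<open>u' s - l * u s\<close> with \<open>u' s\<close> nonnegative.\<close>
  have step1: "exp (l * (t - s)) * (u' t - l * u t) \<ge> - l * u s" if "t \<ge> s" for t
  proof -
    have "exp (l * (s - s)) * (u' s - l * u s) \<le> exp (l * (t - s)) * (u' t - l * u t)"
    proof (rule DERIV_nonneg_imp_nondecreasing[OF that], intro exI conjI)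
      fix x assume x: "s \<le> x" "x \<le> t"
      show "((\<lambda>x. exp (l * (x - s)) * (u' x - l * u x)) has_real_derivative
          exp (l * (x - s)) * (u'' x - l\<^sup>2 * u x)) (at x)"
        by (rule DERIV_cong[OF DERIV_mult[OF dexp DERIV_diff[OF u''[OF x(1)] DERIV_cmult[OF u'[OF x(1)]]]]])
          (simp add: algebra_simps power2_eq_square)
      show "exp (l * (x - s)) * (u'' x - l\<^sup>2 * u x) \<ge> 0"
        using u''_ge[OF x(1)] by simp
    qed
    moreover have "u' s \<ge> 0"
      using M's upos[of s] by (simp add: u'_def)
    ultimately show ?thesis by simp
  qed
  \<comment> \<open>Now the factor D - l. Since \<open>step1\<close> permits a negative slope, a
    multiple of \<open>exp (- 2 * l * (t - s))\<close> is subtracted to offset it; this costs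
    \<open>u s / 2\<close> at \<open>s\<close> and leaves the other half.\<close>
  have step2: "exp (- l * (t - s)) * u t \<ge> u s / 2" if "t \<ge> s" for t
  proof -
    have "exp (- l * (s - s)) * u s - u s / 2 * exp (- 2 * l * (s - s))
        \<le> exp (- l * (t - s)) * u t - u s / 2 * exp (- 2 * l * (t - s))"
    proof (rule DERIV_nonneg_imp_nondecreasing[OF that], intro exI conjI)
      fix x assume x: "s \<le> x" "x \<le> t"
      have e: "exp (- l * (x - s)) = exp (- 2 * l * (x - s)) * exp (l * (x - s))"
        by (simp add: exp_add[symmetric] algebra_simps)
      have arith: "- l * (E * X) * a + b * (E * X) - c / 2 * (- 2 * l * E) = E * (X * (b - l * a) + l * c)"
        for E X a b c :: real
        by (simp add: algebra_simps)
      show "((\<lambda>x. exp (- l * (x - s)) * u x - u s / 2 * exp (- 2 * l * (x - s))) has_real_derivative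
          exp (- 2 * l * (x - s)) * (exp (l * (x - s)) * (u' x - l * u x) + l * u s)) (at x)"
        by (rule DERIV_cong[OF DERIV_diff[OF DERIV_mult[OF dexp u'[OF x(1)]] DERIV_cmult[OF dexp]]])
          (unfold e, rule arith)
      show "exp (- 2 * l * (x - s)) * (exp (l * (x - s)) * (u' x - l * u x) + l * u s) \<ge> 0"
        using step1[OF x(1)] by simp
    qed
    moreover have "u s / 2 * exp (- 2 * l * (t - s)) \<ge> 0"
      using upos[of s] by simp
    ultimately show ?thesis by simp
  qed
  have "(u s / 2 * exp (- l * s))\<^sup>2 * exp (2 * l * t) \<le> M t" if "t \<ge> s" for t
  proof -
    have "exp (l * (t - s)) * (u s / 2) \<le> exp (l * (t - s)) * (exp (- l * (t - s)) * u t)"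
      using step2[OF that] by (intro mult_left_mono) auto
    also have "\<dots> = u t"
      by (simp add: mult.assoc[symmetric] exp_add[symmetric])
    finally have "(exp (l * (t - s)) * (u s / 2))\<^sup>2 \<le> (u t)\<^sup>2"
      using upos[of s] by (intro power_mono) auto
    also have "(exp (l * (t - s)) * (u s / 2))\<^sup>2 = (u s / 2 * exp (- l * s))\<^sup>2 * exp (2 * l * t)"
      by (simp add: power_mult_distrib power_divide exp_double[symmetric] exp_add[symmetric] algebra_simps)
    finally show ?thesis
      using u2[OF that] by simp
  qed
  moreover have "(u s / 2 * exp (- l * s))\<^sup>2 > 0"
    using upos[of s] by simp
  ultimately show ?thesis by blast
qed

subsection \<open>Growth of circle means\<close>

lemma DERIV_integral_parameter:
  fixes q q' :: "real \<Rightarrow> real \<Rightarrow> real"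
  assumes "\<And>t x. ((\<lambda>t. q t x) has_real_derivative q' t x) (at t)"
    and q: "\<And>t. continuous_on UNIV (q t)"
    and q': "continuous_on UNIV (\<lambda>(t, x). q' t x)"
  shows "((\<lambda>t. integral {a..b} (q t)) has_real_derivative integral {a..b} (q' t)) (at t)"
  using leibniz_rule_field_derivative[of UNIV a b q q' t] assms
  by (auto intro!: integrable_continuous_interval intro: continuous_on_subset)

text \<open>The three estimates \<open>M''_ge\<close> (integration by parts and subharmonicity),
  \<open>Q_ge\<close> (Wirtinger) and \<open>P_ge\<close> (Cauchy-Schwarz) combine to the
  differential inequality of \<open>exponential_growth\<close>. Joint continuity in (t, x) serves
  differentiation under the integral; \<open>Gxx\<close> enters only through integrals at fixed
  \<open>t\<close>.\<close>

lemma carleman_growth: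
  fixes G Gt Gx Gtt Gxx :: "real \<Rightarrow> real \<Rightarrow> real"
  assumes dt: "\<And>t x. ((\<lambda>t. G t x) has_real_derivative Gt t x) (at t)"
    and dtt: "\<And>t x. ((\<lambda>t. Gt t x) has_real_derivative Gtt t x) (at t)"
    and dx: "\<And>t x. (G t has_real_derivative Gx t x) (at x)"
    and dxx: "\<And>t x. (Gx t has_real_derivative Gxx t x) (at x)"
    and cont: "continuous_on UNIV (\<lambda>(t, x). G t x)" "continuous_on UNIV (\<lambda>(t, x). Gt t x)"
      "continuous_on UNIV (\<lambda>(t, x). Gtt t x)" "\<And>t. continuous_on UNIV (Gxx t)"
    and nonneg: "\<And>t x. G t x \<ge> 0"
    and subharmonic: "\<And>t x. Gtt t x + Gxx t x \<ge> 0"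
    and periodic: "\<And>t x. G t (x + 2 * pi) = G t x"
    and zero: "\<And>t. \<exists>x\<in>{0..2*pi}. G t x = 0"
    and start: "\<And>x. G r x = 0"
    and nonzero: "r < s" "y \<in> {0..2*pi}" "G s y \<noteq> 0"
    and l: "0 \<le> l" "l < 1/2"
  shows "\<exists>c>0. \<forall>t\<ge>s. integral {0..2*pi} (\<lambda>x. (G t x)\<^sup>2) \<ge> c * exp (2 * l * t)"
proof -
  let ?I = "\<lambda>h. integral {0..2*pi} (h :: real \<Rightarrow> real)"
  have slice: "continuous_on UNIV (h t)" if "continuous_on UNIV (\<lambda>(t, x). h t x)"
    for h :: "real \<Rightarrow> real \<Rightarrow> real" and t
  proof -
    have "continuous_on UNIV (\<lambda>x. (t, x))"
      by (intro continuous_intros)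
    from continuous_on_compose2[OF that this] show ?thesis
      by simp
  qed
  have contx: "continuous_on UNIV (Gx t)" for t
    by (intro continuous_at_imp_continuous_on ballI DERIV_isCont[OF dxx])
  have [continuous_intros]: "continuous_on S (G t)" "continuous_on S (Gt t)" "continuous_on S (Gtt t)"
    "continuous_on S (Gx t)" "continuous_on S (Gxx t)" for S t
    by (rule continuous_on_subset[OF _ subset_UNIV],
        rule slice[OF cont(1)] slice[OF cont(2)] slice[OF cont(3)] contx cont(4))+
  have int: "(h has_integral ?I h) {0..2*pi}" if "continuous_on {0..2*pi} h" for h
    using that by (intro integrable_integral integrable_continuous_interval)
  have sq_nonneg: "?I (\<lambda>x. (h x)\<^sup>2) \<ge> 0" if "continuous_on {0..2*pi} h" for h
    by (rule has_integral_nonneg[OF int]) (auto intro!: continuous_intros that)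
  define M where "M = (\<lambda>t. ?I (\<lambda>x. (G t x)\<^sup>2))"
  define M' where "M' = (\<lambda>t. ?I (\<lambda>x. 2 * G t x * Gt t x))"
  define M'' where "M'' = (\<lambda>t. ?I (\<lambda>x. 2 * (Gt t x)\<^sup>2 + 2 * G t x * Gtt t x))"
  define P where "P = (\<lambda>t. ?I (\<lambda>x. (Gt t x)\<^sup>2))"
  define Q where "Q = (\<lambda>t. ?I (\<lambda>x. (Gx t x)\<^sup>2))"
  have M': "(M has_real_derivative M' t) (at t)" for t
    unfolding M_def M'_def using cont
    by (intro DERIV_integral_parameter)
      (auto intro!: derivative_eq_intros dt continuous_intros simp: case_prod_unfold)
  have M'': "(M' has_real_derivative M'' t) (at t)" for t
    unfolding M'_def M''_def using cont
    by (intro DERIV_integral_parameter)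
      (auto intro!: derivative_eq_intros dt dtt continuous_intros simp: case_prod_unfold power2_eq_square)
  have M''_ge: "M'' t \<ge> 2 * P t + 2 * Q t" for t
  proof -
    \<comment> \<open>The derivative inherits the period, so the boundary terms of the integration
      by parts in \<open>x\<close> cancel.\<close>
    have per: "Gx t (2 * pi) = Gx t 0"
    proof (rule DERIV_unique)
      have "((\<lambda>x. G t (x + 2 * pi)) has_real_derivative Gx t (0 + 2 * pi)) (at 0)"
        using dx DERIV_shift by blast
      then show "(G t has_real_derivative Gx t (2 * pi)) (at 0)"
        by (simp add: periodic)
      show "(G t has_real_derivative Gx t 0) (at 0)"
        by (rule dx)
    qed
    have "((\<lambda>x. (Gx t x)\<^sup>2 + G t x * Gxx t x) has_integral
        G t (2*pi) * Gx t (2*pi) - G t 0 * Gx t 0) {0..2*pi}"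
    proof (rule fundamental_theorem_of_calculus)
      fix x
      have "((\<lambda>x. G t x * Gx t x) has_real_derivative (Gx t x)\<^sup>2 + G t x * Gxx t x) (at x)"
        by (rule DERIV_cong[OF DERIV_mult[OF dx dxx]]) (simp add: power2_eq_square)
      then show "((\<lambda>x. G t x * Gx t x) has_vector_derivative (Gx t x)\<^sup>2 + G t x * Gxx t x) (at x within {0..2*pi})"
        by (simp add: has_field_derivative_at_within flip: has_real_derivative_iff_has_vector_derivative)
    qed simp
    then have parts: "((\<lambda>x. (Gx t x)\<^sup>2 + G t x * Gxx t x) has_integral 0) {0..2*pi}"
      using periodic[of t 0] per by simp
    \<comment> \<open>The integrands differ by \<open>2 * G t x * (Gtt t x + Gxx t x)\<close>;
      subtracting the vanishing integral \<open>parts\<close> trades \<open>G * Gxx\<close> for the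
      square of \<open>Gx\<close>.\<close>
    have "2 * P t + 2 * Q t - 2 * 0 \<le> M'' t"
    proof (rule has_integral_le)
      show "((\<lambda>x. 2 * (Gt t x)\<^sup>2 + 2 * (Gx t x)\<^sup>2 - 2 * ((Gx t x)\<^sup>2 + G t x * Gxx t x))
          has_integral 2 * P t + 2 * Q t - 2 * 0) {0..2*pi}"
        unfolding P_def Q_def
        by (intro has_integral_add has_integral_diff has_integral_mult_right int parts continuous_intros)
      show "((\<lambda>x. 2 * (Gt t x)\<^sup>2 + 2 * G t x * Gtt t x) has_integral M'' t) {0..2*pi}"
        unfolding M''_def by (intro int continuous_intros)
      fix x
      have "G t x * (Gtt t x + Gxx t x) \<ge> 0"
        using nonneg subharmonic by simp
      then show "2 * (Gt t x)\<^sup>2 + 2 * (Gx t x)\<^sup>2 - 2 * ((Gx t x)\<^sup>2 + G t x * Gxx t x)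
          \<le> 2 * (Gt t x)\<^sup>2 + 2 * G t x * Gtt t x"
        by (simp add: algebra_simps)
    qed
    then show ?thesis by simp
  qed
  have Q_ge: "Q t \<ge> l\<^sup>2 * M t" for t
  proof -
    obtain z where "z \<in> {0..2*pi}" "G t z = 0"
      using zero by blast
    then show ?thesis
      unfolding Q_def M_def using l periodic[of t 0]
      by (intro wirtinger_with_zero[OF dx]) (auto intro: continuous_intros)
  qed
  have PQ_nonneg: "P t \<ge> 0" "Q t \<ge> 0" for t
    unfolding P_def Q_def by (intro sq_nonneg continuous_intros)+
  have P_ge: "P t \<ge> (M' t)\<^sup>2 / (4 * M t)" if "M t > 0" for t
  proof -
    \<comment> \<open>This \<open>k\<close> minimises the integral of the square of
      \<open>Gt - k * G\<close>, a quadratic in \<open>k\<close>; nonnegativity of the minimum is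
      the Cauchy-Schwarz inequality.\<close>
    define k where "k = M' t / (2 * M t)"
    have "((\<lambda>x. (Gt t x)\<^sup>2 - k * (2 * G t x * Gt t x) + k\<^sup>2 * (G t x)\<^sup>2) has_integral
        P t - k * M' t + k\<^sup>2 * M t) {0..2*pi}"
      unfolding P_def M'_def M_def
      by (intro has_integral_add has_integral_diff has_integral_mult_right int continuous_intros)
    moreover have "(Gt t x)\<^sup>2 - k * (2 * G t x * Gt t x) + k\<^sup>2 * (G t x)\<^sup>2 = (Gt t x - k * G t x)\<^sup>2" for x
      by (simp add: power2_eq_square algebra_simps)
    ultimately have "0 \<le> P t - k * M' t + k\<^sup>2 * M t"
      by (metis (no_types, lifting) has_integral_nonneg zero_le_power2)
    moreover have "k * M' t - k\<^sup>2 * M t = (M' t)\<^sup>2 / (4 * M t)"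
      using that by (simp add: k_def power2_eq_square field_simps)
    ultimately show ?thesis by linarith
  qed
  have "\<exists>c>0. \<forall>t\<ge>s. M t \<ge> c * exp (2 * l * t)"
  proof (rule exponential_growth[OF M' M''])
    show "M'' t \<ge> 0" for t
      using M''_ge[of t] PQ_nonneg[of t] by linarith
    show "M'' t \<ge> (M' t)\<^sup>2 / (2 * M t) + 2 * l\<^sup>2 * M t" if "M t > 0" for t
    proof -
      have "(M' t)\<^sup>2 / (2 * M t) = 2 * ((M' t)\<^sup>2 / (4 * M t))"
        by simp
      then show ?thesis
        using M''_ge[of t] Q_ge[of t] P_ge[OF that] by linarith
    qed
    show "M r = 0"
      by (simp add: M_def start)
    have "M s \<noteq> 0"
      unfolding M_def using nonzero by (subst integral_eq_0_iff) (auto intro!: continuous_intros)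
    moreover have "M s \<ge> 0"
      unfolding M_def by (intro sq_nonneg continuous_intros)
    ultimately show "M s > 0" by simp
  qed (use nonzero l in auto)
  then show ?thesis
    by (simp add: M_def)
qed

subsection \<open>A smooth convex truncation\<close>

text \<open>The function x - arctan x vanishes to third order at 0, so cutting it off there keeps it
  C^2. Its derivative x^2 / (1 + x^2) increases on the positive axis and stays below 1, which gives
  convexity together with linear growth; a cubic truncation would be C^2 as well but would spoil the
  upper bound on the circle means.\<close>

definition soft_plus :: "real \<Rightarrow> real" where
  "soft_plus x = max 0 x - arctan (max 0 x)"

definition soft_plus' :: "real \<Rightarrow> real" where
  "soft_plus' x = (max 0 x)\<^sup>2 / (1 + (max 0 x)\<^sup>2)"

definition soft_plus'' :: "real \<Rightarrow> real" where
  "soft_plus'' x = 2 * max 0 x / (1 + (max 0 x)\<^sup>2)\<^sup>2"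

lemma one_plus_square_nonzero: "1 + x\<^sup>2 \<noteq> (0 :: real)"
  by (metis add_pos_nonneg less_irrefl zero_le_power2 zero_less_one)

lemma soft_plus_zero [simp]:
  "x \<le> 0 \<Longrightarrow> soft_plus x = 0" "x \<le> 0 \<Longrightarrow> soft_plus' x = 0" "x \<le> 0 \<Longrightarrow> soft_plus'' x = 0"
  by (simp_all add: soft_plus_def soft_plus'_def soft_plus''_def)

lemma soft_plus_pos: "x > 0 \<Longrightarrow> soft_plus x > 0"
  using DERIV_pos_imp_increasing_open[of 0 x "\<lambda>x. x - arctan x"]
  by (force intro!: derivative_eq_intros continuous_intros simp: soft_plus_def field_simps one_plus_square_nonzero add_pos_nonneg)

lemma soft_plus_nonneg: "soft_plus x \<ge> 0"
  using soft_plus_pos[of x] by (cases "x > 0") auto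

lemma soft_plus_le: "soft_plus x \<le> max 0 x"
  by (simp add: soft_plus_def)

lemma soft_plus''_nonneg: "soft_plus'' x \<ge> 0"
  by (simp add: soft_plus''_def)

lemma continuous_on_soft_plus'' [continuous_intros]:
  "continuous_on S h \<Longrightarrow> continuous_on S (\<lambda>x. soft_plus'' (h x))"
  unfolding soft_plus''_def by (intro continuous_intros) (auto simp: one_plus_square_nonzero)

text \<open>The function is \<open>g\<close> on the right half-line and 0 on the left one; the
  conditions at 0 make values and one-sided derivatives agree. It is used once for
  \<open>soft_plus\<close> and once for its derivative.\<close>

lemma DERIV_extend_zero:
  fixes g g' :: "real \<Rightarrow> real"
  assumes "\<And>x. (g has_real_derivative g' x) (at x)" "g 0 = 0" "g' 0 = 0"
  shows "((\<lambda>x. g (max 0 x)) has_real_derivative g' (max 0 x)) (at x)"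
proof -
  have "((\<lambda>x. if x \<in> {0..} then g x else 0) has_vector_derivative (if x \<in> {0..} then g' x else 0)) (at x within UNIV)"
    by (rule has_vector_derivative_If_within_closures[where T = "{..0}"])
      (use assms in \<open>auto simp: has_real_derivative_iff_has_vector_derivative[symmetric] intro: has_field_derivative_at_within\<close>)
  moreover have "(\<lambda>x. if x \<in> {0..} then g x else 0) = (\<lambda>x. g (max 0 x))"
    using assms by (auto simp: max_def)
  moreover have "(if x \<in> {0..} then g' x else 0) = g' (max 0 x)"
    using assms by (auto simp: max_def)
  ultimately show ?thesis
    by (simp add: has_real_derivative_iff_has_vector_derivative)
qed

lemma DERIV_soft_plus: "(soft_plus has_real_derivative soft_plus' x) (at x)"
  unfolding soft_plus_def soft_plus'_def
  by (rule DERIV_extend_zero[where g = "\<lambda>x. x - arctan x" and g' = "\<lambda>x. x\<^sup>2 / (1 + x\<^sup>2)"])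
    (auto intro!: derivative_eq_intros simp: one_plus_square_nonzero field_simps)

lemma DERIV_soft_plus': "(soft_plus' has_real_derivative soft_plus'' x) (at x)"
  unfolding soft_plus'_def soft_plus''_def
  by (rule DERIV_extend_zero[where g = "\<lambda>x. x\<^sup>2 / (1 + x\<^sup>2)" and g' = "\<lambda>x. 2 * x / (1 + x\<^sup>2)\<^sup>2"])
    (auto intro!: derivative_eq_intros simp: one_plus_square_nonzero one_plus_square_nonzero[unfolded power2_eq_square]
        field_simps power2_eq_square)

lemma continuous_on_soft_plus [continuous_intros]:
  assumes "continuous_on S h"
  shows "continuous_on S (\<lambda>x. soft_plus (h x))" "continuous_on S (\<lambda>x. soft_plus' (h x))"
  by (auto intro!: continuous_on_compose2[OF _ assms subset_UNIV] continuous_at_imp_continuous_on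
      intro: DERIV_isCont[OF DERIV_soft_plus] DERIV_isCont[OF DERIV_soft_plus'])

subsection \<open>Subharmonic functions extended by zero\<close>

text \<open>As \<open>q\<close> vanishes on \<open>A - N\<close>, the extension equals
  \<open>q\<close> on the open set \<open>A\<close> and 0 on the open set \<open>- N\<close>, and
  these two cover the space.\<close>

lemma continuous_on_zero_extension:
  fixes q :: "'a::topological_space \<Rightarrow> 'b::real_normed_vector"
  assumes "open A" "closed N" "N \<subseteq> A" "continuous_on A q" "\<And>z. z \<in> A - N \<Longrightarrow> q z = 0"
  shows "continuous_on UNIV (\<lambda>z. if z \<in> N then q z else 0)"
proof -
  let ?e = "\<lambda>z. if z \<in> N then q z else 0"
  have "continuous_on A ?e"
    by (rule continuous_on_eq[OF assms(4)]) (use assms in auto)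
  moreover have "continuous_on (- N) ?e"
    by (rule continuous_on_eq[OF continuous_on_const[of _ 0]]) auto
  ultimately have "continuous_on (A \<union> - N) ?e"
    using assms by (intro continuous_on_open_Un) auto
  moreover have "A \<union> - N = UNIV"
    using assms by auto
  ultimately show ?thesis
    by simp
qed

text \<open>The same gluing along a curve: near \<open>s\<close> the curve stays in \<open>A\<close>
  or stays in \<open>- N\<close>, so locally the extension is \<open>q\<close> along the curve or
  constantly 0.\<close>

lemma DERIV_zero_extension:
  fixes q :: "'a::topological_space \<Rightarrow> real"
  assumes "open A" "closed N" "N \<subseteq> A" "\<And>z. z \<in> A - N \<Longrightarrow> q z = 0"
    and "isCont \<gamma> s"
    and deriv: "\<gamma> s \<in> N \<Longrightarrow> ((\<lambda>s. q (\<gamma> s)) has_real_derivative d) (at s)"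
  shows "((\<lambda>s. if \<gamma> s \<in> N then q (\<gamma> s) else 0) has_real_derivative (if \<gamma> s \<in> N then d else 0)) (at s)"
proof -
  have "(\<gamma> \<longlongrightarrow> \<gamma> s) (nhds s)"
    using \<open>isCont \<gamma> s\<close> by (simp add: isCont_def tendsto_at_iff_tendsto_nhds)
  note near = topological_tendstoD[OF this]
  show ?thesis
  proof (cases "\<gamma> s \<in> N")
    case True
    have "\<forall>\<^sub>F x in nhds s. \<gamma> x \<in> A"
      using True assms by (intro near) auto
    then have "\<forall>\<^sub>F x in nhds s. (if \<gamma> x \<in> N then q (\<gamma> x) else 0) = q (\<gamma> x)"
      by (rule eventually_mono) (use assms in auto)
    then show ?thesis
      using deriv[OF True] True by (subst DERIV_cong_ev[OF refl _ refl]) auto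
  next
    case False
    have "\<forall>\<^sub>F x in nhds s. \<gamma> x \<in> - N"
      using False assms by (intro near) auto
    then have "\<forall>\<^sub>F x in nhds s. (if \<gamma> x \<in> N then q (\<gamma> x) else 0) = 0"
      by (rule eventually_mono) auto
    then show ?thesis
      using False by (subst DERIV_cong_ev[OF refl _ refl]) auto
  qed
qed

section \<open>Truncated logarithms of holomorphic functions\<close>

text \<open>The real part of the logarithmic derivative, obtained from the gradient of the norm so
  that no branch of the complex logarithm has to be chosen.\<close>

lemma DERIV_ln_norm:
  fixes w :: "real \<Rightarrow> complex"
  assumes w: "(w has_vector_derivative w') (at s)" "w s \<noteq> 0" and "m > 0"
  shows "((\<lambda>s. ln (norm (w s) / m)) has_real_derivative Re (w' / w s)) (at s)"
proof -
  have "(norm has_derivative (\<lambda>h. h \<bullet> sgn (w s))) (at (w s))"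
    using GDERIV_norm[OF w(2)] by (simp add: gderiv_def)
  from diff_chain_at[OF w(1)[unfolded has_vector_derivative_def] this]
  have "((\<lambda>s. norm (w s)) has_real_derivative w' \<bullet> sgn (w s)) (at s)"
    by (simp add: o_def has_field_derivative_def mult_commute_abs)
  then have "((\<lambda>s. norm (w s) / m) has_real_derivative (w' \<bullet> sgn (w s)) / m) (at s)"
    by (rule DERIV_cdivide)
  moreover have "norm (w s) / m > 0"
    using w(2) \<open>m > 0\<close> by simp
  ultimately have "((\<lambda>s. ln (norm (w s) / m)) has_real_derivative
      inverse (norm (w s) / m) * ((w' \<bullet> sgn (w s)) / m)) (at s)"
    by (intro DERIV_chain2[where f = ln and g = "\<lambda>s. norm (w s) / m", OF DERIV_ln])
  moreover have "inverse (norm (w s) / m) * ((w' \<bullet> sgn (w s)) / m) = Re (w' / w s)"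
  proof -
    have "inverse (norm (w s) / m) * ((w' \<bullet> sgn (w s)) / m) = (w' \<bullet> w s) / (norm (w s))\<^sup>2"
      using w(2) \<open>m > 0\<close> by (simp add: sgn_div_norm field_simps power2_eq_square)
    then show ?thesis
      by (simp add: inner_complex_def Re_divide cmod_power2)
  qed
  ultimately show ?thesis
    by simp
qed

text \<open>Away from the zeros of \<open>F\<close> the function log(|F|/m) is harmonic, so a convex
  function of it is subharmonic. The zeros lie off \<open>N\<close> because \<open>m > 0\<close>,
  and closedness of \<open>N\<close> in the whole plane lets the zero extension remain smooth beyond
  \<open>S\<close>.\<close>

lemma holomorphic_carleman_growth:
  fixes F :: "complex \<Rightarrow> complex"
  assumes "open S" "F holomorphic_on S" "m > 0"
    and N: "N = {z \<in> S. norm (F z) \<ge> m}" "closed N"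
    and periodic: "\<And>z. z + 2 * pi * \<i> \<in> S \<longleftrightarrow> z \<in> S" "\<And>z. z \<in> S \<Longrightarrow> F (z + 2 * pi * \<i>) = F z"
    and zero: "\<And>t. \<exists>x\<in>{0..2*pi}. Complex t x \<notin> N"
    and start: "\<And>x. Complex r x \<notin> N"
    and nonzero: "r < s" "y \<in> {0..2*pi}" "Complex s y \<in> S" "norm (F (Complex s y)) > m"
    and l: "0 \<le> l" "l < 1/2"
  shows "\<exists>c>0. \<forall>t\<ge>s. integral {0..2*pi}
      (\<lambda>x. (if Complex t x \<in> N then soft_plus (ln (norm (F (Complex t x)) / m)) else 0)\<^sup>2)
    \<ge> c * exp (2 * l * t)"
proof -
  define A where "A = {z \<in> S. F z \<noteq> 0}"
  have "A = S \<inter> F -` (- {0})"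
    by (auto simp: A_def)
  moreover have "open (S \<inter> F -` (- {0}))"
    using assms by (intro continuous_open_preimage holomorphic_on_imp_continuous_on) auto
  ultimately have A: "open A"
    by simp
  have NA: "N \<subseteq> A"
    using \<open>m > 0\<close> by (auto simp: N A_def)
  have holF: "F holomorphic_on A"
    using assms by (auto simp: A_def intro: holomorphic_on_subset)
  define L where "L = (\<lambda>z. deriv F z / F z)"
  have holL: "L holomorphic_on A"
    unfolding L_def using holF A by (intro holomorphic_intros) (auto simp: A_def)
  have contA: "continuous_on A (\<lambda>z. ln (norm (F z) / m))" "continuous_on A L" "continuous_on A (deriv L)"
    using holF holL A \<open>m > 0\<close>
    by (auto intro!: continuous_intros holomorphic_on_imp_continuous_on holomorphic_deriv simp: A_def)
  define h where "h = (\<lambda>z. ln (norm (F z) / m))"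
  have h_le: "h z \<le> 0" if "z \<in> A - N" for z
    using that \<open>m > 0\<close> by (auto simp: h_def N A_def)
  \<comment> \<open>First and second derivatives of \<open>soft_plus (h z)\<close> in the direction
    \<open>v\<close>. The choices \<open>v = 1\<close> and \<open>v = \<i>\<close> give the
    \<open>t\<close>- and \<open>x\<close>-derivatives, so one computation serves both.\<close>
  define D where "D = (\<lambda>v z. soft_plus' (h z) * Re (v * L z))"
  define DD where "DD = (\<lambda>v z. soft_plus'' (h z) * (Re (v * L z))\<^sup>2 + soft_plus' (h z) * Re (v * (v * deriv L z)))"
  define ext where "ext = (\<lambda>q z. if z \<in> N then q z else (0::real))"
  have cont: "continuous_on UNIV (ext (\<lambda>z. soft_plus (h z)))" "continuous_on UNIV (ext (D v))"
    "continuous_on UNIV (ext (DD v))" for v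
    unfolding ext_def using h_le contA
    by (auto intro!: continuous_on_zero_extension[OF A N(2) NA] continuous_intros
        simp: D_def DD_def h_def[abs_def])
  have dh: "((\<lambda>s. h (\<gamma> s)) has_real_derivative Re (v * L (\<gamma> s))) (at s)"
    if \<gamma>: "(\<gamma> has_vector_derivative v) (at s)" "\<gamma> s \<in> A" for \<gamma> v s
  proof -
    have "(F has_field_derivative deriv F (\<gamma> s)) (at (\<gamma> s))"
      using holF A \<gamma>(2) by (rule holomorphic_derivI)
    from DERIV_ln_norm[OF field_vector_diff_chain_at[OF \<gamma>(1) this] _ \<open>m > 0\<close>] \<gamma>(2) show ?thesis
      by (simp add: o_def h_def L_def A_def)
  qed
  have dL: "((\<lambda>s. Re (v * L (\<gamma> s))) has_real_derivative Re (v * (v * deriv L (\<gamma> s)))) (at s)"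
    if \<gamma>: "(\<gamma> has_vector_derivative v) (at s)" "\<gamma> s \<in> A" for \<gamma> v s
  proof -
    have "(L has_field_derivative deriv L (\<gamma> s)) (at (\<gamma> s))"
      using holL A \<gamma>(2) by (rule holomorphic_derivI)
    from field_vector_diff_chain_at[OF \<gamma>(1) this]
    have "((\<lambda>s. v * L (\<gamma> s)) has_vector_derivative v * (v * deriv L (\<gamma> s))) (at s)"
      unfolding o_def by (rule has_vector_derivative_mult_right)
    then show ?thesis
      by (rule has_field_derivative_Re)
  qed
  have isCont_curve: "isCont \<gamma> s" if "(\<gamma> has_vector_derivative v) (at s)" for \<gamma> :: "real \<Rightarrow> complex" and v s
    using that by (rule has_vector_derivative_continuous)
  have first: "((\<lambda>s. ext (\<lambda>z. soft_plus (h z)) (\<gamma> s)) has_real_derivative ext (D v) (\<gamma> s)) (at s)"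
    if \<gamma>: "(\<gamma> has_vector_derivative v) (at s)" for \<gamma> v s
    unfolding ext_def
  proof (rule DERIV_zero_extension[OF A N(2) NA _ isCont_curve[OF \<gamma>]])
    show "soft_plus (h z) = 0" if "z \<in> A - N" for z
      using h_le[OF that] by simp
    assume "\<gamma> s \<in> N"
    then show "((\<lambda>s. soft_plus (h (\<gamma> s))) has_real_derivative D v (\<gamma> s)) (at s)"
      unfolding D_def using NA by (intro DERIV_chain2[OF DERIV_soft_plus] dh \<gamma>) auto
  qed
  have second: "((\<lambda>s. ext (D v) (\<gamma> s)) has_real_derivative ext (DD v) (\<gamma> s)) (at s)"
    if \<gamma>: "(\<gamma> has_vector_derivative v) (at s)" for \<gamma> v s
    unfolding ext_def
  proof (rule DERIV_zero_extension[OF A N(2) NA _ isCont_curve[OF \<gamma>]])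
    show "D v z = 0" if "z \<in> A - N" for z
      using h_le[OF that] by (simp add: D_def)
    assume "\<gamma> s \<in> N"
    then have in_A: "\<gamma> s \<in> A"
      using NA by auto
    show "((\<lambda>s. D v (\<gamma> s)) has_real_derivative DD v (\<gamma> s)) (at s)"
      unfolding D_def DD_def
      by (rule DERIV_cong[OF DERIV_mult[OF DERIV_chain2[OF DERIV_soft_plus' dh[OF \<gamma> in_A]] dL[OF \<gamma> in_A]]])
        (simp add: power2_eq_square algebra_simps)
  qed
  have curves: "((\<lambda>t. Complex t x) has_vector_derivative 1) (at t)"
    "((\<lambda>x. Complex t x) has_vector_derivative \<i>) (at x)" for t x
    by (auto intro!: derivative_eq_intros simp: has_vector_derivative_complex_iff)
  have cont2: "continuous_on UNIV (\<lambda>(t, x). k (Complex t x))" if "continuous_on UNIV k" for k :: "complex \<Rightarrow> real"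
    unfolding case_prod_unfold by (rule continuous_on_compose2[OF that]) (auto intro!: continuous_intros)
  have per: "z + 2 * pi * \<i> \<in> N \<longleftrightarrow> z \<in> N" for z
    using periodic by (auto simp: N)
  have shift: "Complex t (x + 2 * pi) = Complex t x + 2 * pi * \<i>" for t x
    by (simp add: complex_eq_iff)
  have "\<exists>c>0. \<forall>t\<ge>s. integral {0..2*pi} (\<lambda>x. (ext (\<lambda>z. soft_plus (h z)) (Complex t x))\<^sup>2) \<ge> c * exp (2 * l * t)"
  proof (rule carleman_growth[OF first[OF curves(1)] second[OF curves(1)] first[OF curves(2)] second[OF curves(2)]
        cont2[OF cont(1)] cont2[OF cont(2)] cont2[OF cont(3)]])
    show "continuous_on UNIV (\<lambda>x. ext (DD \<i>) (Complex t x))" for t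
      by (rule continuous_on_compose2[OF cont(3)]) (auto intro!: continuous_intros)
    show "ext (\<lambda>z. soft_plus (h z)) (Complex t x) \<ge> 0" for t x
      by (simp add: ext_def soft_plus_nonneg)
    \<comment> \<open>The terms with \<open>deriv L\<close> cancel because the squares of 1 and
      \<open>\<i>\<close> are opposite; what remains is \<open>soft_plus''\<close> times a sum of
      squares.\<close>
    show "ext (DD 1) (Complex t x) + ext (DD \<i>) (Complex t x) \<ge> 0" for t x
      by (simp add: ext_def DD_def soft_plus''_nonneg)
    show "ext (\<lambda>z. soft_plus (h z)) (Complex t (x + 2 * pi)) = ext (\<lambda>z. soft_plus (h z)) (Complex t x)" for t x
      unfolding shift ext_def per using periodic by (auto simp: N h_def)
    show "\<exists>x\<in>{0..2*pi}. ext (\<lambda>z. soft_plus (h z)) (Complex t x) = 0" for t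
      using zero[of t] by (auto simp: ext_def)
    show "ext (\<lambda>z. soft_plus (h z)) (Complex r x) = 0" for x
      using start[of x] by (simp add: ext_def)
    have "h (Complex s y) > 0"
      unfolding h_def using nonzero \<open>m > 0\<close> by (intro ln_gt_zero) simp
    from soft_plus_pos[OF this] nonzero \<open>m > 0\<close> show "ext (\<lambda>z. soft_plus (h z)) (Complex s y) \<noteq> 0"
      by (simp add: ext_def N)
  qed (use nonzero l in auto)
  then show ?thesis
    unfolding ext_def h_def .
qed

subsection \<open>Simply connected domains\<close>

text \<open>A circle inside \<open>W\<close> would have winding number 1 about its centre
  \<open>a\<close>, yet simple connectedness forces winding number 0 about points outside
  \<open>W\<close>.\<close>

lemma simply_connected_circle_exit:
  fixes r :: real
  assumes "simply_connected W" "a \<notin> W" "r > 0"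
  shows "\<exists>x\<in>{0..2*pi}. a + of_real r * cis x \<notin> W"
proof (rule ccontr)
  assume "\<not> ?thesis"
  then have inW: "a + of_real r * cis x \<in> W" if "x \<in> {0..2*pi}" for x
    using that by blast
  have "path_image (circlepath a r) \<subseteq> W"
  proof
    fix z assume "z \<in> path_image (circlepath a r)"
    then obtain x where "x \<in> {0..1}" "z = a + r * exp (2 * of_real pi * \<i> * of_real x)"
      by (auto simp: path_image_def circlepath)
    then have "z = a + r * cis (2 * pi * x)" "2 * pi * x \<in> {0..2*pi}"
      by (auto simp: cis_conv_exp algebra_simps mult_left_le)
    then show "z \<in> W"
      using inW by blast
  qed
  then have "winding_number (circlepath a r) a = 0"
    using assms by (intro simply_connected_imp_winding_number_zero) auto
  then show False
    using winding_number_circlepath_centre[OF \<open>r > 0\<close>, of a] by simp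
qed

text \<open>A limit point outside \<open>W\<close> would be a frontier point, where the limsup below
  \<open>m\<close> excludes nearby values of modulus at least \<open>m\<close>. Inside
  \<open>W\<close> continuity suffices.\<close>

lemma closed_superlevel:
  fixes f :: "complex \<Rightarrow> complex"
  assumes "continuous_on W f"
    and bdry: "\<And>\<zeta>. \<zeta> \<in> frontier W \<Longrightarrow> Limsup (at \<zeta> within W) (\<lambda>z. ereal (norm (f z))) \<le> ereal K"
    and "open W" "K < m"
  shows "closed {z \<in> W. norm (f z) \<ge> m}" (is "closed ?N")
  unfolding closed_limpt
proof (intro allI impI)
  fix x assume x: "x islimpt ?N"
  show "x \<in> ?N"
  proof (cases "x \<in> W")
    case True
    have "closedin (top_of_set W) (W \<inter> (\<lambda>z. norm (f z)) -` {m..})"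
      using assms by (intro continuous_closedin_preimage continuous_intros) auto
    moreover have "W \<inter> (\<lambda>z. norm (f z)) -` {m..} = ?N"
      by auto
    ultimately show ?thesis
      using x True by (simp add: closedin_limpt)
  next
    case False
    have "x islimpt W"
      using x by (rule islimpt_subset) auto
    then have "x \<in> frontier W"
      using False \<open>open W\<close> by (simp add: frontier_def closure_def interior_open)
    from bdry[OF this] \<open>K < m\<close> have "Limsup (at x within W) (\<lambda>z. ereal (norm (f z))) < ereal m"
      by (metis ereal_less_eq(3) le_less_trans less_ereal.simps(1))
    then have "\<forall>\<^sub>F z in at x within W. ereal (norm (f z)) < ereal m"
      by (rule Limsup_lessD)
    then obtain d where "d > 0" "\<And>z. z \<in> W \<Longrightarrow> z \<noteq> x \<Longrightarrow> dist z x < d \<Longrightarrow> norm (f z) < m"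
      by (auto simp: eventually_at)
    moreover obtain z where "z \<in> ?N" "z \<noteq> x" "dist z x < d"
      using x \<open>d > 0\<close> by (auto simp: islimpt_approachable)
    ultimately show ?thesis
      by force
  qed
qed

section \<open>Comparison of growth rates\<close>

text \<open>After division by \<open>exp (2 * k * t)\<close> the left side tends to 0. The factor
  \<open>2 * pi\<close> is the length of the interval of integration.\<close>

lemma exponential_beats_subexponential:
  fixes b k B D c :: real
  assumes "0 < b" "b < k" "c > 0"
  shows "\<forall>\<^sub>F t in at_top. 2 * pi * (B + D * exp (b * t))\<^sup>2 < c * exp (2 * k * t)"
proof -
  have decay: "((\<lambda>t. exp (- e * t)) \<longlongrightarrow> (0::real)) at_top" if "e > 0" for e :: real
    by (rule filterlim_compose[OF exp_at_bot] filterlim_tendsto_neg_mult_at_bot tendsto_const)+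
      (use that filterlim_ident in auto)
  have "((\<lambda>t. 2 * pi * (B * exp (- k * t) + D * exp (- (k - b) * t))\<^sup>2) \<longlongrightarrow> 2 * pi * (B * 0 + D * 0)\<^sup>2) at_top"
    using assms by (intro tendsto_intros decay) auto
  then have "\<forall>\<^sub>F t in at_top. 2 * pi * (B * exp (- k * t) + D * exp (- (k - b) * t))\<^sup>2 < c"
    using \<open>c > 0\<close> by (intro order_tendstoD(2)) auto
  then show ?thesis
  proof (rule eventually_mono)
    fix t
    assume "2 * pi * (B * exp (- k * t) + D * exp (- (k - b) * t))\<^sup>2 < c"
    then have "2 * pi * (B * exp (- k * t) + D * exp (- (k - b) * t))\<^sup>2 * exp (2 * k * t) < c * exp (2 * k * t)"
      by simp
    moreover have "(B * exp (- k * t) + D * exp (- (k - b) * t)) * exp (k * t) = B + D * exp (b * t)"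
      by (simp add: ring_distribs mult.assoc flip: exp_add)
    then have "(B * exp (- k * t) + D * exp (- (k - b) * t))\<^sup>2 * exp (2 * k * t) = (B + D * exp (b * t))\<^sup>2"
      by (metis exp_double mult.assoc power_mult_distrib)
    ultimately show "2 * pi * (B + D * exp (b * t))\<^sup>2 < c * exp (2 * k * t)"
      by (metis mult.assoc)
  qed
qed

text \<open>The exponent is nonnegative, so the additive \<open>C\<close> is absorbed by doubling
  the exponential term. The absolute value makes the bound nonnegative, hence valid for the
  truncated logarithm too.\<close>

lemma ln_growth_bound:
  fixes C m q R y :: real
  assumes "C > 0" "m > 0" "y > 0" "0 \<le> R" "y \<le> C * exp (C * R powr q) + C"
  shows "ln (y / m) \<le> \<bar>ln (2 * C / m)\<bar> + C * R powr q"
proof -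
  have "y \<le> 2 * C * exp (C * R powr q)"
  proof -
    have "C * 1 \<le> C * exp (C * R powr q)"
      using assms by (intro mult_left_mono) auto
    with assms show ?thesis
      by linarith
  qed
  then have "y / m \<le> 2 * C / m * exp (C * R powr q)"
    using assms by (simp add: divide_right_mono)
  then have "ln (y / m) \<le> ln (2 * C / m * exp (C * R powr q))"
    using assms by (intro ln_mono) auto
  also have "\<dots> = ln (2 * C / m) + C * R powr q"
    using assms by (subst ln_mult) auto
  finally show ?thesis
    by linarith
qed

section \<open>The contradiction between lower and upper growth\<close>

lemma superlevel_empty:
  fixes f :: "complex \<Rightarrow> complex"
  assumes "open W" "simply_connected W" "a \<notin> W" "f holomorphic_on W"
    and bdry: "\<And>\<zeta>. \<zeta> \<in> frontier W \<Longrightarrow> Limsup (at \<zeta> within W) (\<lambda>z. ereal (norm (f z))) \<le> ereal K"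
    and p: "C > 0" "0 < p" "p < 1/4"
    and growth: "\<And>z. z \<in> W \<Longrightarrow> norm (f z) \<le> C * exp (C * norm z powr (2 * p)) + C"
    and m: "m > 0" "K < m" and "z \<in> W"
  shows "norm (f z) \<le> m"
proof (rule ccontr)
  assume "\<not> norm (f z) \<le> m"
  define N0 where "N0 = {z \<in> W. norm (f z) \<ge> m}"
  \<comment> \<open>\<open>E\<close> has period \<open>2 * pi * \<i>\<close>, omits the value
    \<open>a\<close>, and maps the line with real part \<open>t\<close> onto the circle of radius
    \<open>exp t\<close> about \<open>a\<close>.\<close>
  define E where "E = (\<lambda>w. a + exp w)"
  define S where "S = E -` W"
  define F where "F = (\<lambda>w. f (E w))"
  define N where "N = {w \<in> S. norm (F w) \<ge> m}"
  have "closed N0"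
    unfolding N0_def using assms by (intro closed_superlevel[OF _ bdry] holomorphic_on_imp_continuous_on)
  have N_vimage: "N = E -` N0"
    by (auto simp: N_def N0_def S_def F_def)
  have contE: "continuous_on UNIV E"
    unfolding E_def by (intro continuous_intros)
  have E_Complex: "E (Complex t x) = a + of_real (exp t) * cis x" for t x
    by (simp add: E_def exp_eq_polar)
  have "a \<notin> N0"
    using assms by (simp add: N0_def)
  then obtain e where e: "e > 0" "ball a e \<subseteq> - N0"
    using \<open>closed N0\<close> by (meson ComplI open_Compl open_contains_ball)
  have "z \<noteq> a"
    using assms by auto
  \<comment> \<open>Logarithmic polar coordinates of \<open>z\<close> about \<open>a\<close>, giving
    a preimage of \<open>z\<close> under \<open>E\<close> within one period.\<close>
  define s where "s = ln (norm (z - a))"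
  define y where "y = Arg2pi (z - a)"
  have y: "y \<in> {0..2*pi}"
    unfolding y_def using Arg2pi[of "z - a"] by auto
  have Ez: "E (Complex s y) = z"
  proof -
    have "z - a = norm (z - a) * cis y"
      using Arg2pi[of "z - a"] by (auto simp: is_Arg_def y_def cis_conv_exp)
    moreover have "exp s = norm (z - a)"
      using \<open>z \<noteq> a\<close> by (simp add: s_def)
    ultimately show ?thesis
      by (simp only: E_Complex) (metis add_diff_cancel_left' diff_add_cancel add.commute)
  qed
  \<comment> \<open>The first entry puts the circle of radius \<open>exp r\<close> inside the ball
    of radius \<open>e\<close>, which misses \<open>N0\<close>; the second ensures
    \<open>r < s\<close>.\<close>
  define r where "r = min (ln e - 1) (s - 1)"
  define u where "u = (\<lambda>w. soft_plus (ln (norm (F w) / m)))"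
  \<comment> \<open>The rate \<open>p + 1/4\<close> is the midpoint of \<open>2 * p\<close> and 1/2:
    small enough for the Wirtinger inequality, larger than the rate that \<open>growth\<close>
    allows.\<close>
  have "\<exists>c>0. \<forall>t\<ge>s. integral {0..2*pi} (\<lambda>x. (if Complex t x \<in> N then u (Complex t x) else 0)\<^sup>2)
      \<ge> c * exp (2 * (p + 1/4) * t)"
    unfolding u_def
  proof (rule holomorphic_carleman_growth[OF _ _ m(1) N_def])
    show "open S"
      unfolding S_def using contE \<open>open W\<close> by (simp add: open_vimage)
    have "E holomorphic_on S"
      unfolding E_def by (intro holomorphic_intros)
    from holomorphic_on_compose_gen[OF this assms(4)] show "F holomorphic_on S"
      by (simp add: o_def F_def S_def image_subset_iff)
    show "closed N"
      unfolding N_vimage using contE \<open>closed N0\<close> by (simp add: closed_vimage)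
    have "E (w + 2 * pi * \<i>) = E w" for w
      by (simp add: E_def exp_add)
    then show "w + 2 * pi * \<i> \<in> S \<longleftrightarrow> w \<in> S" "F (w + 2 * pi * \<i>) = F w" for w
      by (simp_all add: S_def F_def)
    show "\<exists>x\<in>{0..2*pi}. Complex t x \<notin> N" for t
      using simply_connected_circle_exit[OF assms(2,3), of "exp t"]
      by (auto simp: N_def S_def E_Complex)
    show "Complex r x \<notin> N" for x
    proof -
      have "exp r < exp (ln e)"
        by (simp add: r_def min_def)
      then have "E (Complex r x) \<in> ball a e"
        using e by (simp add: E_Complex dist_norm norm_mult)
      with e show ?thesis
        by (auto simp: N_vimage)
    qed
    show "r < s"
      by (simp add: r_def)
    show "Complex s y \<in> S" "norm (F (Complex s y)) > m"
      using assms \<open>\<not> norm (f z) \<le> m\<close> by (simp_all add: S_def F_def Ez)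
  qed (use y p in auto)
  then obtain c where "c > 0"
    and lower: "\<And>t. t \<ge> s \<Longrightarrow> c * exp (2 * (p + 1/4) * t)
      \<le> integral {0..2*pi} (\<lambda>x. (if Complex t x \<in> N then u (Complex t x) else 0)\<^sup>2)"
    by blast
  \<comment> \<open>Once \<open>norm a \<le> exp t\<close>, points of the circle have modulus at
    most \<open>2 * exp t\<close>; this is the origin of the power of 2 in \<open>D\<close>.\<close>
  define B where "B = \<bar>ln (2 * C / m)\<bar>"
  define D where "D = C * 2 powr (2 * p)"
  have upper: "integral {0..2*pi} (\<lambda>x. (if Complex t x \<in> N then u (Complex t x) else 0)\<^sup>2)
      \<le> 2 * pi * (B + D * exp (2 * p * t))\<^sup>2" if t: "norm a \<le> exp t" for t
  proof -
    let ?q = "\<lambda>x. (if Complex t x \<in> N then u (Complex t x) else 0)\<^sup>2"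
    have BD: "0 \<le> B + D * exp (2 * p * t)"
      using p by (simp add: B_def D_def)
    have "?q x \<le> (B + D * exp (2 * p * t))\<^sup>2" for x
    proof (cases "Complex t x \<in> N")
      case True
      let ?w = "E (Complex t x)"
      have w: "?w \<in> W" "norm (f ?w) \<ge> m"
        using True by (auto simp: N_def S_def F_def)
      have "norm ?w \<le> 2 * exp t"
        using norm_triangle_ineq[of a "of_real (exp t) * cis x"] t by (simp add: E_Complex norm_mult)
      then have "norm ?w powr (2 * p) \<le> (2 * exp t) powr (2 * p)"
        using p by (intro powr_mono2) auto
      also have "\<dots> = 2 powr (2 * p) * exp (2 * p * t)"
        by (simp add: powr_mult exp_powr_real mult.commute)
      finally have "C * norm ?w powr (2 * p) \<le> D * exp (2 * p * t)"
        using p by (simp add: D_def mult.assoc)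
      moreover have "ln (norm (f ?w) / m) \<le> B + C * norm ?w powr (2 * p)"
        unfolding B_def using p m w growth[OF w(1)] by (intro ln_growth_bound) auto
      ultimately have "u (Complex t x) \<le> B + D * exp (2 * p * t)"
        using soft_plus_le[of "ln (norm (f ?w) / m)"] BD by (simp add: u_def F_def)
      then show ?thesis
        using True by (simp add: u_def soft_plus_nonneg power_mono)
    qed simp
    moreover have const: "((\<lambda>x. (B + D * exp (2 * p * t))\<^sup>2) has_integral
        2 * pi * (B + D * exp (2 * p * t))\<^sup>2) {0..2*pi}"
      using has_integral_const_real[of "(B + D * exp (2 * p * t))\<^sup>2" 0 "2*pi"] by simp
    \<comment> \<open>If the integrand were not integrable, its integral would be 0 by convention,
      and the bound would still hold.\<close>
    ultimately show ?thesis
      by (cases "?q integrable_on {0..2*pi}")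
        (auto intro: has_integral_le[OF integrable_integral const] simp: not_integrable_integral)
  qed
  have "\<forall>\<^sub>F t in at_top. 2 * pi * (B + D * exp (2 * p * t))\<^sup>2 < c * exp (2 * (p + 1/4) * t)"
    using exponential_beats_subexponential[of "2 * p" "p + 1/4" c B D] p \<open>c > 0\<close> by simp
  moreover have "\<forall>\<^sub>F t in at_top. norm a \<le> exp t"
    using exp_at_top by (simp add: filterlim_at_top)
  ultimately have "\<forall>\<^sub>F t :: real in at_top. False"
    using eventually_ge_at_top[of s]
  proof eventually_elim
    case (elim t)
    then show ?case
      using lower[of t] upper[of t] by linarith
  qed
  then show False
    by simp
qed

text \<open>A nonempty proper subset of the connected plane has a frontier point. For open
  \<open>W\<close> it is a limit point of \<open>W\<close>, so the limsup there is over a nontrivial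
  filter and cannot be negative.\<close>

lemma boundary_bound_nonneg:
  fixes f :: "complex \<Rightarrow> complex"
  assumes "open W" "W \<noteq> {}" "W \<noteq> UNIV"
    and bdry: "\<And>\<zeta>. \<zeta> \<in> frontier W \<Longrightarrow> Limsup (at \<zeta> within W) (\<lambda>z. ereal (norm (f z))) \<le> ereal K"
  shows "K \<ge> 0"
proof -
  obtain \<zeta> where \<zeta>: "\<zeta> \<in> frontier W"
    using assms frontier_eq_empty by blast
  then have "\<zeta> islimpt W"
    using \<open>open W\<close> by (auto simp: frontier_def closure_def interior_open)
  then have "ereal 0 \<le> Limsup (at \<zeta> within W) (\<lambda>z. ereal (norm (f z)))"
    by (intro le_Limsup) (auto simp: trivial_limit_within)
  from order_trans[OF this bdry[OF \<zeta>]] show ?thesis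
    by simp
qed

theorem corollary1:
  fixes W :: "complex set" and f :: "complex \<Rightarrow> complex" and K C p :: real
  assumes "open W" and "connected W" and "W \<noteq> {}" and "simply_connected W" and "W \<noteq> UNIV"
    and "f analytic_on W"
    and "\<And>\<zeta>. \<zeta> \<in> frontier W \<Longrightarrow>
           Limsup (at \<zeta> within W) (\<lambda>z. ereal (norm (f z))) \<le> ereal K"
    and "C > 0" and "0 < p" and "p < 1/4"
    and "\<And>z. z \<in> W \<Longrightarrow> norm (f z) \<le> C * exp (C * norm z powr (2 * p)) + C"
  shows "\<forall>z\<in>W. norm (f z) \<le> K"
proof
  fix z assume "z \<in> W"
  obtain a where "a \<notin> W"
    using \<open>W \<noteq> UNIV\<close> by blast
  have "K \<ge> 0"
    by (rule boundary_bound_nonneg[OF assms(1,3,5,7)])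
  show "norm (f z) \<le> K"
  \<comment> \<open>The bound is shown for every \<open>m > K\<close>; since \<open>K\<close> is
    nonnegative, such \<open>m\<close> are positive and log(|f|/m) makes sense where f is
    nonzero.\<close>
  proof (rule dense_ge)
    fix m assume "K < m"
    with \<open>K \<ge> 0\<close> show "norm (f z) \<le> m"
      by (intro superlevel_empty[OF assms(1,4) \<open>a \<notin> W\<close> analytic_imp_holomorphic[OF assms(6)] assms(7-11) _ _ \<open>z \<in> W\<close>])
        auto
  qed
qed

end
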